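(* For every odd $m\ge3$, a pair $(\theta,\phi)$ of equivalence relations on $X=\{1,2,3,4\}$ is a typed congruence of the alternating core $H_m$ if and only if $$\theta\in\operatorname{Con}(H_m)\quad\text{and}\quad\phi\subseteq\theta.$$ Consequently the core has exactly $36$ typed congruence pairs and exactly eight diagonal congruences (typed congruences of the form $(\theta,\theta)$).
   Context: Let $X=\{1,2,3,4\}$, let $\epsilon:X\to\mathbb Z_2$ be given by $\epsilon(1)=\epsilon(4)=0$, $\epsilon(2)=\epsilon(3)=1$, and let $\eta:\mathbb Z_2\to X$ be $\eta(0)=4$, $\eta(1)=3$. For odd $m\ge3$, $H_m:X^m\to X$ is defined by: $H_m(x_1,\dots,x_m)=1$ if $x_1=\dots=x_m=1$; $=2$ if $x_1=\dots=x_m=2$; and $=\eta(\epsilon(x_1)+\dots+\epsilon(x_m))$ otherwise, with the sum taken in $\mathbb Z_2$. $\operatorname{Con}(H_m)$ is the set of equivalence relations on $X$ compatible with $H_m$. $H_m$ is regarded as an alternating two-sorted operation: the odd positions are carrier entries, the even positions are index entries, the output is a carrier element, and both sorts have underlying set $X$. A pair $(\theta,\phi)$ of equivalence relations on $X$ is a typed congruence if, whenever $x_i\mathrel\theta x_i'$ for all odd $i$ and $x_i\mathrel\phi x_i'$ for all even $i$, one has $H_m(x_1,\dots,x_m)\mathrel\theta H_m(x_1',\dots,x_m')$. *)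

theory Defs
  imports Main "HOL-Library.Z2"
begin

text \<open>The carrier is the set \<open>{1, 2, 3, 4}\<close> of natural numbers; \<open>\<int>\<^sub>2\<close> is the type \<^typ>\<open>bit\<close>, where \<open>1 + 1 = 0\<close>.\<close>

definition X :: "nat set" where
  "X = {1, 2, 3, 4}"

text \<open>Only the values of \<open>\<epsilon>\<close> on \<^const>\<open>X\<close> matter.\<close>

definition eps :: "nat \<Rightarrow> bit" where
  "eps x = (if x = 2 \<or> x = 3 then 1 else 0)"

definition eta :: "bit \<Rightarrow> nat" where
  "eta b = (if b = 0 then 4 else 3)"

text \<open>An \<open>m\<close>-tuple \<open>(x\<^sub>1, \<dots>, x\<^sub>m)\<close> is a function on \<^typ>\<open>nat\<close> of which only
  the values at the positions \<open>1, \<dots>, m\<close> are relevant.\<close>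

definition H :: "nat \<Rightarrow> (nat \<Rightarrow> nat) \<Rightarrow> nat" where
  "H m x =
    (if \<forall>i\<in>{1..m}. x i = 1 then 1
     else if \<forall>i\<in>{1..m}. x i = 2 then 2
     else eta (\<Sum>i=1..m. eps (x i)))"

text \<open>\<^term>\<open>equiv X \<theta>\<close> includes \<open>\<theta> \<subseteq> X \<times> X\<close>, so tuples that are related entrywise
  automatically have their entries in \<^const>\<open>X\<close>.\<close>

definition Con :: "nat \<Rightarrow> (nat \<times> nat) set set" where
  "Con m = {\<theta>. equiv X \<theta> \<and>
    (\<forall>x x'. (\<forall>i\<in>{1..m}. (x i, x' i) \<in> \<theta>) \<longrightarrow> (H m x, H m x') \<in> \<theta>)}"

definition typed_congruence :: "nat \<Rightarrow> (nat \<times> nat) set \<Rightarrow> (nat \<times> nat) set \<Rightarrow> bool" where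
  "typed_congruence m \<theta> \<phi> \<longleftrightarrow> equiv X \<theta> \<and> equiv X \<phi> \<and>
    (\<forall>x x'. (\<forall>i\<in>{1..m}. odd i \<longrightarrow> (x i, x' i) \<in> \<theta>) \<and>
            (\<forall>i\<in>{1..m}. even i \<longrightarrow> (x i, x' i) \<in> \<phi>)
      \<longrightarrow> (H m x, H m x') \<in> \<theta>)"

end

theory Submission
  imports Defs
begin

text \<open>Since \<open>m\<close> is odd, \<open>\<epsilon>\<close> turns \<open>H\<^sub>m\<close> into addition in \<open>\<int>\<^sub>2\<close>, and replacing one entry of
  a constant tuple already shows what a typed congruence \<open>(\<theta>, \<phi>)\<close> needs: \<open>1 \<theta> 3\<close> or \<open>2 \<theta> 4\<close>
  forces \<open>3 \<theta> 4\<close>, and \<open>1 \<theta> 2\<close> forces \<open>\<theta>\<close> to be total; the same replacement in an even position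
  forces \<open>\<phi> \<subseteq> \<theta>\<close>.  Conversely these conditions suffice: related tuples whose \<open>\<epsilon>\<close>-sums differ have
  an entry pair of different parity, and every such pair forces \<open>3 \<theta> 4\<close>.  The pairs are then
  counted by encoding an equivalence relation by its six off-diagonal truth values.\<close>

section \<open>Translations of \<open>H\<close> and what they force on a typed congruence\<close>

lemma of_nat_bit: "of_nat n = (of_bool (odd n) :: bit)"
  by (induction n) auto

text \<open>The \<open>m - 1\<close> remaining entries are even in number, so their parities cancel
  and only \<open>a\<close> counts, outside the constant tuples. The value is independent of
  \<open>k\<close>; hence carrier and index positions give the same translations.\<close>

lemma H_const_upd:
  assumes "odd m" "m \<ge> 3" "k \<in> {1..m}"
  shows "H m ((\<lambda>_. c)(k := a)) = (if a = c \<and> (c = 1 \<or> c = 2) then c else eta (eps a))"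
proof -
  let ?x = "(\<lambda>_. c)(k := a)"
  \<comment> \<open>A second position, still holding \<open>c\<close>: the tuple is constant only if
    \<open>a = c\<close>.\<close>
  obtain j where j: "j \<in> {1..m}" "j \<noteq> k"
    using that[of "if k = 1 then 2 else 1"] assms(2) by (auto split: if_splits)
  have const: "(\<forall>i\<in>{1..m}. ?x i = d) \<longleftrightarrow> a = d \<and> c = d" for d
    using j assms(3) by auto
  have "(\<Sum>i=1..m. eps (?x i)) = eps a + (\<Sum>i\<in>{1..m} - {k}. eps (?x i))"
    using assms(3) by (simp add: sum.remove)
  also have "(\<Sum>i\<in>{1..m} - {k}. eps (?x i)) = of_nat (m - 1) * eps c"
    using assms(3) by simp
  also have "of_nat (m - 1) = (0 :: bit)"
    using assms(1) by (simp add: of_nat_bit del: of_nat_diff)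
  finally have "(\<Sum>i=1..m. eps (?x i)) = eps a" by simp
  then show ?thesis unfolding H_def const by auto
qed

text \<open>The parity classes are {1,4} and {2,3}. The clauses make every related pair of different
  parity force 3 \<theta> 4; the last also makes an equivalence relation with 1 \<theta> 2
  total.\<close>

definition admissible :: "(nat \<times> nat) set \<Rightarrow> bool" where
  "admissible \<theta> \<longleftrightarrow> ((1, 3) \<in> \<theta> \<longrightarrow> (3, 4) \<in> \<theta>) \<and> ((2, 4) \<in> \<theta> \<longrightarrow> (3, 4) \<in> \<theta>) \<and>
    ((1, 2) \<in> \<theta> \<longrightarrow> (1, 3) \<in> \<theta> \<and> (3, 4) \<in> \<theta>)"

lemma typed_congruence_translation:
  assumes "odd m" "m \<ge> 3" "typed_congruence m \<theta> \<phi>" "(a, b) \<in> \<theta> \<union> \<phi>" "c \<in> X"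
  shows "(if a = c \<and> (c = 1 \<or> c = 2) then c else eta (eps a),
          if b = c \<and> (c = 1 \<or> c = 2) then c else eta (eps b)) \<in> \<theta>"
proof -
  have refl: "(c, c) \<in> \<theta>" "(c, c) \<in> \<phi>"
    using assms(3,5) by (auto simp: typed_congruence_def equiv_def refl_on_def)
  \<comment> \<open>Position 1 is a carrier entry and position 2 an index entry, so the pair is
    inserted where its own relation governs.\<close>
  define k :: nat where "k = (if (a, b) \<in> \<theta> then 1 else 2)"
  have k: "k \<in> {1..m}" using assms(2) by (auto simp: k_def)
  have "(H m ((\<lambda>_. c)(k := a)), H m ((\<lambda>_. c)(k := b))) \<in> \<theta>"
    using assms(3) unfolding typed_congruence_def
    by (elim conjE, elim allE impE) (use refl assms(4) in \<open>auto simp: k_def\<close>)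
  then show ?thesis unfolding H_const_upd[OF assms(1,2) k] .
qed

lemma typed_congruence_admissible:
  assumes "odd m" "m \<ge> 3" "typed_congruence m \<theta> \<phi>"
  shows "admissible \<theta>"
proof -
  have eq: "equiv X \<theta>" using assms(3) by (simp add: typed_congruence_def)
  have t: "(if a = c \<and> (c = 1 \<or> c = 2) then c else eta (eps a),
          if b = c \<and> (c = 1 \<or> c = 2) then c else eta (eps b)) \<in> \<theta>"
    if "(a, b) \<in> \<theta>" "c \<in> X" for a b c
    using typed_congruence_translation[OF assms, of a b c] that by simp
  \<comment> \<open>With \<open>c = 3\<close> no constant case arises, and the translation is
    \<open>eta\<close> after \<open>eps\<close>.\<close>
  have "(4, 3) \<in> \<theta>" if "(1, 3) \<in> \<theta> \<or> (1, 2) \<in> \<theta>"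
    using that t[of 1 3 3] t[of 1 2 3] by (auto simp: X_def eta_def eps_def)
  moreover have "(3, 4) \<in> \<theta>" if "(2, 4) \<in> \<theta>"
    using that t[of 2 4 3] by (auto simp: X_def eta_def eps_def)
  \<comment> \<open>With \<open>c = 1\<close> the translation fixes 1 and sends 2 to 3.\<close>
  moreover have "(1, 3) \<in> \<theta>" if "(1, 2) \<in> \<theta>"
    using that t[of 1 2 1] by (auto simp: X_def eta_def eps_def)
  ultimately show ?thesis
    using eq unfolding admissible_def equiv_def sym_def by blast
qed

text \<open>The translation for \<open>c = 1\<close> fixes 1, 3, 4, and the one for
  \<open>c = 2\<close> fixes 2, 3, 4, so every pair except 1, 2 is fixed by one of them. For 1, 2
  the translations with \<open>c = 1, 3, 2\<close> give the chain 1 \<theta> 3 \<theta> 4 \<theta>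
  2.\<close>

lemma typed_congruence_subset:
  assumes "odd m" "m \<ge> 3" "typed_congruence m \<theta> \<phi>"
  shows "\<phi> \<subseteq> \<theta>"
proof (rule subrelI)
  fix a b assume ab: "(a, b) \<in> \<phi>"
  have eq: "equiv X \<theta>" "equiv X \<phi>" using assms(3) by (simp_all add: typed_congruence_def)
  then have X: "a \<in> X" "b \<in> X" using ab by (auto simp: equiv_def)
  have refl: "(a, a) \<in> \<theta>" using eq(1) X by (auto simp: equiv_def refl_on_def)
  have sym: "(y, x) \<in> \<theta>" if "(x, y) \<in> \<theta>" for x y
    using that eq(1) by (auto simp: equiv_def sym_def)
  have trans: "(x, z) \<in> \<theta>" if "(x, y) \<in> \<theta>" "(y, z) \<in> \<theta>" for x y z
    using that eq(1) by (auto simp: equiv_def intro: transD)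
  have l12: "(1, 2) \<in> \<theta>" if "(1, 3) \<in> \<theta>" "(4, 2) \<in> \<theta>" "(4, 3) \<in> \<theta>"
    using trans[OF trans[OF that(1) sym[OF that(3)]] that(2)] .
  have l21: "(2, 1) \<in> \<theta>" if "(3, 1) \<in> \<theta>" "(2, 4) \<in> \<theta>" "(3, 4) \<in> \<theta>"
    using trans[OF trans[OF that(2) sym[OF that(3)]] that(1)] .
  note t = typed_congruence_translation[OF assms, of a b]
  have "(if a = 1 then 1 else eta (eps a), if b = 1 then 1 else eta (eps b)) \<in> \<theta>"
       "(if a = 2 then 2 else eta (eps a), if b = 2 then 2 else eta (eps b)) \<in> \<theta>"
       "(eta (eps a), eta (eps b)) \<in> \<theta>"
    using t[of 1] t[of 2] t[of 3] ab by (auto simp: X_def split: if_splits)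
  then show "(a, b) \<in> \<theta>"
    using X refl l12 l21 unfolding X_def by (auto simp: eta_def eps_def)
qed

section \<open>Sufficiency: compatibility of admissible equivalence relations with
  \<open>H\<close>\<close>

lemma H_compatible:
  assumes "odd m" and eq: "equiv X \<theta>" and adm: "admissible \<theta>"
    and rel: "\<And>i. i \<in> {1..m} \<Longrightarrow> (x i, x' i) \<in> \<theta>"
  shows "(H m x, H m x') \<in> \<theta>"
proof -
  \<comment> \<open>The generic branch of \<open>H\<close>, also evaluated on constant
    tuples.\<close>
  define g where "g x = eta (\<Sum>i=1..m. eps (x i))" for x
  have refl: "(a, a) \<in> \<theta>" if "a \<in> X" for a
    using that eq by (auto simp: equiv_def refl_on_def)
  have sym: "(b, a) \<in> \<theta>" if "(a, b) \<in> \<theta>" for a b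
    using that eq by (auto simp: equiv_def sym_def)
  have trans: "(a, c) \<in> \<theta>" if "(a, b) \<in> \<theta>" "(b, c) \<in> \<theta>" for a b c
    using that eq by (auto simp: equiv_def intro: transD)
  have inX: "a \<in> X \<and> b \<in> X" if "(a, b) \<in> \<theta>" for a b
    using that eq by (auto simp: equiv_def)
  have g34: "g x = 3 \<or> g x = 4" for x by (auto simp: g_def eta_def)
  have par: "(3, 4) \<in> \<theta>" if ab: "(a, b) \<in> \<theta>" "eps a \<noteq> eps b" for a b
  proof -
    have "a \<in> X" "b \<in> X" using inX ab by auto
    then show ?thesis
      using ab adm sym[OF ab(1)] unfolding X_def admissible_def eps_def
      by (auto intro: sym split: if_splits)
  qed
  have gg: "(g y, g y') \<in> \<theta>" if r: "\<And>i. i \<in> {1..m} \<Longrightarrow> (y i, y' i) \<in> \<theta>" for y y'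
  proof (cases "\<forall>i\<in>{1..m}. eps (y i) = eps (y' i)")
    case True
    then have "g y = g y'" by (auto simp: g_def intro!: arg_cong[of _ _ eta] sum.cong)
    then show ?thesis using g34[of y'] by (auto intro!: refl simp: X_def)
  next
    case False
    then have "(3, 4) \<in> \<theta>" using par r by blast
    then show ?thesis using g34[of y] g34[of y'] sym refl[of 3] refl[of 4] by (auto simp: X_def)
  qed
  \<comment> \<open>The mixed case: a constant tuple of value \<open>c\<close> against one that is
    not constantly \<open>c\<close>.\<close>
  have const: "(c, g y) \<in> \<theta>"
    if c: "c = 1 \<or> c = 2" and r: "\<And>i. i \<in> {1..m} \<Longrightarrow> (c, y i) \<in> \<theta>"
      and n: "\<not> (\<forall>i\<in>{1..m}. y i = c)" for c y
  proof -
    obtain i where i: "i \<in> {1..m}" "y i \<noteq> c" using n by auto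
    have ci: "(c, y i) \<in> \<theta>" using r i by blast
    show ?thesis
    proof (cases "\<exists>j\<in>{1..m}. eps (y j) \<noteq> eps c")
      case True
      then obtain j where j: "(c, y j) \<in> \<theta>" "eps (y j) \<noteq> eps c" using r by blast
      have 34: "(3, 4) \<in> \<theta>" using par[OF j(1)] j(2) by auto
      \<comment> \<open>Needed for \<open>c = 2\<close> and \<open>y j = 1\<close>, where
        admissibility supplies 1 \<theta> 3.\<close>
      have "(2, 3) \<in> \<theta>" if "(2, 1) \<in> \<theta>" "(1, 3) \<in> \<theta>"
        using trans[OF that] .
      moreover have "y j \<in> X" using inX j by blast
      ultimately have "(c, 3) \<in> \<theta> \<or> (c, 4) \<in> \<theta>"
        using j c adm 34 sym[OF j(1)] unfolding X_def admissible_def eps_def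
        by (auto split: if_splits)
      then show ?thesis using 34 g34[of y] sym trans by metis
    next
      case False
      \<comment> \<open>All parities agree with that of \<open>c\<close>, and \<open>m\<close> is
        odd, so the sum is \<open>eps c\<close>. The entry \<open>y i\<close> is the other member of
        the parity class of \<open>c\<close>, which is exactly \<open>eta (eps c)\<close>; thus
        \<open>g y = y i\<close>.\<close>
      then have "(\<Sum>i=1..m. eps (y i)) = of_nat m * eps c" by simp
      also have "of_nat m = (1 :: bit)"
        using assms(1) by (simp add: of_nat_bit)
      finally have g: "g y = eta (eps c)" by (simp add: g_def)
      have "eps (y i) = eps c" "y i \<in> X" using False i inX ci by auto
      then have "y i = eta (eps c)" using c i
        by (auto simp: X_def eps_def eta_def split: if_splits)
      then show ?thesis using g ci by simp
    qed
  qed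
  have r': "(x' i, x i) \<in> \<theta>" if "i \<in> {1..m}" for i using rel[OF that] by (rule sym)
  have ne: "1 \<in> {1..m}" using \<open>odd m\<close> by (auto elim: oddE)
  have Hg: "H m y = (if \<forall>i\<in>{1..m}. y i = 1 then 1 else if \<forall>i\<in>{1..m}. y i = 2 then 2 else g y)" for y
    by (simp add: H_def g_def)
  have Hc: "H m y = c" if "c \<in> {1, 2}" "\<forall>i\<in>{1..m}. y i = c" for c y
  proof -
    have "(\<forall>i\<in>{1..m}. y i = d) \<longleftrightarrow> c = d" for d using that(2) ne by metis
    then show ?thesis using that(1) by (auto simp: Hg)
  qed
  have Hn: "H m y = g y" if "\<not> (\<exists>c\<in>{1, 2}. \<forall>i\<in>{1..m}. y i = c)" for y
    using that unfolding Hg by auto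
  show ?thesis
  proof (cases "\<exists>c\<in>{1, 2}. \<forall>i\<in>{1..m}. x i = c")
    case True
    then obtain c where c: "c \<in> {1, 2}" "\<forall>i\<in>{1..m}. x i = c" by blast
    have r: "(c, x' i) \<in> \<theta>" if "i \<in> {1..m}" for i using rel[OF that] c(2) that by simp
    show ?thesis
    proof (cases "\<exists>d\<in>{1, 2}. \<forall>i\<in>{1..m}. x' i = d")
      case True
      then obtain d where d: "d \<in> {1, 2}" "\<forall>i\<in>{1..m}. x' i = d" by blast
      then show ?thesis using Hc[OF c] Hc[OF d] r[OF ne] ne by simp
    next
      case False
      then have "(c, g x') \<in> \<theta>" using c(1) r by (intro const) auto
      then show ?thesis using Hc[OF c] Hn[OF False] by simp
    qed
  next
    case x: False
    show ?thesis
    proof (cases "\<exists>d\<in>{1, 2}. \<forall>i\<in>{1..m}. x' i = d")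
      case True
      then obtain d where d: "d \<in> {1, 2}" "\<forall>i\<in>{1..m}. x' i = d" by blast
      have "(d, x i) \<in> \<theta>" if "i \<in> {1..m}" for i using r'[OF that] d(2) that by simp
      then have "(d, g x) \<in> \<theta>" using d(1) x by (intro const) auto
      then show ?thesis using Hc[OF d] Hn[OF x] sym by simp
    next
      case False
      then show ?thesis using Hn[OF x] Hn[OF False] gg[OF rel] by simp
    qed
  qed
qed

lemma typed_congruence_iff:
  assumes "odd m" "m \<ge> 3"
  shows "typed_congruence m \<theta> \<phi> \<longleftrightarrow> equiv X \<theta> \<and> equiv X \<phi> \<and> admissible \<theta> \<and> \<phi> \<subseteq> \<theta>"
proof
  assume "typed_congruence m \<theta> \<phi>"
  then show "equiv X \<theta> \<and> equiv X \<phi> \<and> admissible \<theta> \<and> \<phi> \<subseteq> \<theta>"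
    using typed_congruence_admissible[OF assms] typed_congruence_subset[OF assms]
    by (simp add: typed_congruence_def)
next
  assume r: "equiv X \<theta> \<and> equiv X \<phi> \<and> admissible \<theta> \<and> \<phi> \<subseteq> \<theta>"
  have "(H m x, H m x') \<in> \<theta>"
    if o: "\<forall>i\<in>{1..m}. odd i \<longrightarrow> (x i, x' i) \<in> \<theta>"
      and e: "\<forall>i\<in>{1..m}. even i \<longrightarrow> (x i, x' i) \<in> \<phi>" for x x'
  proof (rule H_compatible[OF assms(1)])
    show "(x i, x' i) \<in> \<theta>" if "i \<in> {1..m}" for i
      using that o e r by (cases "odd i") auto
  qed (use r in simp_all)
  then show "typed_congruence m \<theta> \<phi>"
    using r by (simp add: typed_congruence_def)
qed

text \<open>Reduces membership in \<open>Con m\<close> to the criterion above with \<phi> =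
  \<theta>, where the inclusion is trivial.\<close>

lemma Con_iff_typed_congruence: "\<theta> \<in> Con m \<longleftrightarrow> typed_congruence m \<theta> \<theta>"
proof -
  have "(\<forall>i\<in>{1..m}. (x i, x' i) \<in> \<theta>) \<longleftrightarrow>
    (\<forall>i\<in>{1..m}. odd i \<longrightarrow> (x i, x' i) \<in> \<theta>) \<and> (\<forall>i\<in>{1..m}. even i \<longrightarrow> (x i, x' i) \<in> \<theta>)"
    for x x' :: "nat \<Rightarrow> nat" by blast
  then show ?thesis unfolding Con_def typed_congruence_def by simp
qed

section \<open>Encoding equivalence relations on \<open>X\<close> by bits, and counting\<close>

type_synonym bits = "bool \<times> bool \<times> bool \<times> bool \<times> bool \<times> bool"

definition bits :: "(nat \<times> nat) set \<Rightarrow> bits" where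
  "bits \<theta> = ((1, 2) \<in> \<theta>, (1, 3) \<in> \<theta>, (1, 4) \<in> \<theta>, (2, 3) \<in> \<theta>, (2, 4) \<in> \<theta>, (3, 4) \<in> \<theta>)"

text \<open>Transitivity of a symmetric relation on three points, read from its three edges: never
  exactly two of them hold.\<close>

definition triangle :: "bool \<Rightarrow> bool \<Rightarrow> bool \<Rightarrow> bool" where
  "triangle p q r \<longleftrightarrow> (p \<and> q \<longrightarrow> r) \<and> (p \<and> r \<longrightarrow> q) \<and> (q \<and> r \<longrightarrow> p)"

text \<open>The four triangles are the point sets 123, 124, 134 and 234, in this order.\<close>

fun transitive_bits :: "bits \<Rightarrow> bool" where
  "transitive_bits (a, b, c, d, e, f) \<longleftrightarrow>
    triangle a b d \<and> triangle a c e \<and> triangle b c f \<and> triangle d e f"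

fun admissible_bits :: "bits \<Rightarrow> bool" where
  "admissible_bits (a, b, c, d, e, f) \<longleftrightarrow> (b \<longrightarrow> f) \<and> (e \<longrightarrow> f) \<and> (a \<longrightarrow> b \<and> f)"

fun le_bits :: "bits \<Rightarrow> bits \<Rightarrow> bool" where
  "le_bits (a, b, c, d, e, f) (a', b', c', d', e', f') \<longleftrightarrow>
    (a \<longrightarrow> a') \<and> (b \<longrightarrow> b') \<and> (c \<longrightarrow> c') \<and> (d \<longrightarrow> d') \<and> (e \<longrightarrow> e') \<and> (f \<longrightarrow> f')"

text \<open>An executable enumeration, so that the counts can be evaluated; its entries are the
  codes of the 15 partitions of \<open>X\<close>.\<close>

definition bits_list :: "bits list" where
  "bits_list = (let B = [False, True] in filter transitive_bits
    (List.product B (List.product B (List.product B (List.product B (List.product B B))))))"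

lemma admissible_bits: "admissible_bits (bits \<theta>) \<longleftrightarrow> admissible \<theta>"
  by (simp add: bits_def admissible_def)

text \<open>The six bits cover the pairs with smaller first entry; symmetry and reflexivity supply
  the others. Antisymmetry of inclusion then yields injectivity of \<open>bits\<close>.\<close>

lemma le_bits:
  assumes "equiv X \<phi>" "equiv X \<theta>"
  shows "le_bits (bits \<phi>) (bits \<theta>) \<longleftrightarrow> \<phi> \<subseteq> \<theta>"
proof
  assume le: "le_bits (bits \<phi>) (bits \<theta>)"
  show "\<phi> \<subseteq> \<theta>"
  proof (rule subrelI)
    fix a b assume ab: "(a, b) \<in> \<phi>"
    have X: "a \<in> X" "b \<in> X" and ba: "(b, a) \<in> \<phi>"
      using ab assms(1) by (auto simp: equiv_def dest: symD)
    have refl: "(a, a) \<in> \<theta>" using assms(2) X by (auto simp: equiv_def refl_on_def)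
    have sym: "(b, a) \<in> \<theta> \<Longrightarrow> (a, b) \<in> \<theta>" using assms(2) by (auto simp: equiv_def dest: symD)
    show "(a, b) \<in> \<theta>"
      using le X ab ba refl sym unfolding X_def bits_def by auto
  qed
qed (auto simp: bits_def)

lemma bij_betw_bits: "bij_betw bits {\<theta>. equiv X \<theta>} (set bits_list)"
  unfolding bij_betw_def
proof
  show "inj_on bits {\<theta>. equiv X \<theta>}"
  proof (rule inj_onI)
    fix \<theta> \<phi> assume "\<theta> \<in> {\<theta>. equiv X \<theta>}" "\<phi> \<in> {\<theta>. equiv X \<theta>}" "bits \<theta> = bits \<phi>"
    moreover have "le_bits t t" for t by (cases t) auto
    ultimately show "\<theta> = \<phi>"
      using le_bits[of \<theta> \<phi>] le_bits[of \<phi> \<theta>] by auto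
  qed
  have "set [False, True] = UNIV" by (simp add: UNIV_bool)
  then have list: "set bits_list = {t. transitive_bits t}"
    unfolding bits_list_def Let_def set_filter set_product by (simp only: UNIV_Times_UNIV UNIV_I simp_thms)
  show "bits ` {\<theta>. equiv X \<theta>} = set bits_list"
    unfolding list
  proof (intro equalityI subsetI)
    fix t assume "t \<in> bits ` {\<theta>. equiv X \<theta>}"
    then obtain \<theta> where t: "t = bits \<theta>" and eq: "equiv X \<theta>" by auto
    have sym: "(b, a) \<in> \<theta> \<longleftrightarrow> (a, b) \<in> \<theta>" for a b
      using eq by (auto simp: equiv_def dest: symD)
    have trans: "(a, c) \<in> \<theta>" if "(a, b) \<in> \<theta>" "(b, c) \<in> \<theta>" for a b c
      using that eq by (auto simp: equiv_def intro: transD)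
    have "triangle ((a, b) \<in> \<theta>) ((a, c) \<in> \<theta>) ((b, c) \<in> \<theta>)" for a b c
      unfolding triangle_def using sym trans by meson
    then show "t \<in> {t. transitive_bits t}" by (simp add: t bits_def)
  next
    fix t assume tr: "t \<in> {t. transitive_bits t}"
    obtain a b c d e f where t: "t = (a, b, c, d, e, f)" by (cases t)
    have tri: "triangle a b d" "triangle a c e" "triangle b c f" "triangle d e f"
      using tr by (simp_all add: t)
    \<comment> \<open>Decodes the bits as the strict upper triangle; \<theta> is its reflexive and
      symmetric closure on \<open>X\<close>.\<close>
    define q :: "nat \<Rightarrow> nat \<Rightarrow> bool" where "q x y \<longleftrightarrow>
      (if x = 1 then if y = 2 then a else if y = 3 then b else y = 4 \<and> c
       else if x = 2 then if y = 3 then d else y = 4 \<and> e else x = 3 \<and> y = 4 \<and> f)" for x y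
    define \<theta> where "\<theta> = {(x, y). x \<in> X \<and> y \<in> X \<and> (x = y \<or> q x y \<or> q y x)}"
    \<comment> \<open>Transitivity, checked on all 64 triples of points; triples of distinct points
      use the triangle conditions.\<close>
    have "(x = y \<or> q x y \<or> q y x) \<longrightarrow> (y = z \<or> q y z \<or> q z y) \<longrightarrow> (x = z \<or> q x z \<or> q z x)"
      if "x \<in> X" "y \<in> X" "z \<in> X" for x y z
      using that unfolding X_def
      by (elim insertE emptyE; simp add: q_def; use tri in \<open>unfold triangle_def, blast\<close>)
    then have "trans \<theta>" unfolding trans_def \<theta>_def by blast
    moreover have "sym \<theta>" by (auto simp: sym_def \<theta>_def)
    moreover have "refl_on X \<theta>" by (auto simp: refl_on_def \<theta>_def)
    moreover have "\<theta> \<subseteq> X \<times> X" by (auto simp: \<theta>_def)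
    ultimately have "equiv X \<theta>" by (simp add: equiv_def)
    moreover have "bits \<theta> = t"
      by (simp add: bits_def t \<theta>_def q_def X_def)
    ultimately show "t \<in> bits ` {\<theta>. equiv X \<theta>}" by auto
  qed
qed

text \<open>Transports a count of pairs of relations along the bijection \<open>bits\<close> to a
  finite enumeration that can be evaluated.\<close>

lemma card_equiv_pairs:
  assumes "\<And>\<theta> \<phi>. equiv X \<theta> \<Longrightarrow> equiv X \<phi> \<Longrightarrow> P \<theta> \<phi> \<longleftrightarrow> Q (bits \<theta>) (bits \<phi>)"
  shows "card {(\<theta>, \<phi>). equiv X \<theta> \<and> equiv X \<phi> \<and> P \<theta> \<phi>} =
    card (set (filter (\<lambda>(s, t). Q s t) (List.product bits_list bits_list)))"
proof (rule bij_betw_same_card)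
  have "inj_on (map_prod bits bits) ({\<theta>. equiv X \<theta>} \<times> {\<theta>. equiv X \<theta>})"
    using bij_betw_bits by (intro map_prod_inj_on) (auto simp: bij_betw_def)
  then have "inj_on (map_prod bits bits) {(\<theta>, \<phi>). equiv X \<theta> \<and> equiv X \<phi> \<and> P \<theta> \<phi>}"
    by (rule inj_on_subset) auto
  moreover have "map_prod bits bits ` {(\<theta>, \<phi>). equiv X \<theta> \<and> equiv X \<phi> \<and> P \<theta> \<phi>} =
    set (filter (\<lambda>(s, t). Q s t) (List.product bits_list bits_list))"
    using bij_betw_imp_surj_on[OF bij_betw_bits, symmetric] assms by (force simp: image_iff)
  ultimately show "bij_betw (map_prod bits bits) {(\<theta>, \<phi>). equiv X \<theta> \<and> equiv X \<phi> \<and> P \<theta> \<phi>}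
    (set (filter (\<lambda>(s, t). Q s t) (List.product bits_list bits_list)))"
    by (simp add: bij_betw_def)
qed

theorem corollary6p5:
  fixes m :: nat
  assumes "odd m" and "m \<ge> 3"
  shows "(\<forall>\<theta> \<phi>. equiv X \<theta> \<and> equiv X \<phi> \<longrightarrow>
            (typed_congruence m \<theta> \<phi> \<longleftrightarrow> \<theta> \<in> Con m \<and> \<phi> \<subseteq> \<theta>))
       \<and> card {(\<theta>, \<phi>). typed_congruence m \<theta> \<phi>} = 36
       \<and> card {(\<theta>, \<phi>). typed_congruence m \<theta> \<phi> \<and> \<theta> = \<phi>} = 8"
proof (intro conjI)
  note iff = typed_congruence_iff[OF assms]
  show "\<forall>\<theta> \<phi>. equiv X \<theta> \<and> equiv X \<phi> \<longrightarrow>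
      (typed_congruence m \<theta> \<phi> \<longleftrightarrow> \<theta> \<in> Con m \<and> \<phi> \<subseteq> \<theta>)"
    unfolding Con_iff_typed_congruence iff by blast
  have "{(\<theta>, \<phi>). typed_congruence m \<theta> \<phi>} =
      {(\<theta>, \<phi>). equiv X \<theta> \<and> equiv X \<phi> \<and> admissible \<theta> \<and> \<phi> \<subseteq> \<theta>}"
    unfolding iff ..
  also have "card \<dots> = card (set (filter (\<lambda>(s, t). admissible_bits s \<and> le_bits t s)
      (List.product bits_list bits_list)))"
    by (rule card_equiv_pairs) (simp add: admissible_bits le_bits)
  \<comment> \<open>By nontrivial blocks, the admissible \<theta> are: none, 34, 14, 23, 14|23, 134,
    234, 1234. They have 1, 2, 2, 2, 4, 5, 5, 15 refinements \<phi>, in total 36.\<close>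
  also have "\<dots> = 36" by code_simp
  finally show "card {(\<theta>, \<phi>). typed_congruence m \<theta> \<phi>} = 36" .
  have "{(\<theta>, \<phi>). typed_congruence m \<theta> \<phi> \<and> \<theta> = \<phi>} =
      {(\<theta>, \<phi>). equiv X \<theta> \<and> equiv X \<phi> \<and> admissible \<theta> \<and> \<theta> = \<phi>}"
    unfolding iff by auto
  also have "card \<dots> = card (set (filter (\<lambda>(s, t). admissible_bits s \<and> s = t)
      (List.product bits_list bits_list)))"
    \<comment> \<open>Injectivity of \<open>bits\<close> turns \<theta> = \<phi> into equality of
      codes.\<close>
    using bij_betw_imp_inj_on[OF bij_betw_bits]
    by (intro card_equiv_pairs) (auto simp: admissible_bits inj_on_def)
  also have "\<dots> = 8" by code_simp
  finally show "card {(\<theta>, \<phi>). typed_congruence m \<theta> \<phi> \<and> \<theta> = \<phi>} = 8" .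
qed

end
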